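(* Let $G$ and $H$ both be stiff digraphs. Then a homomorphism $f:G\to H$ is a bihomotopy equivalence if and only if it is an isomorphism.
   Context: A digraph $G$ consists of a finite vertex set $V(G)$ and an edge set $E(G)\subseteq V(G)\times V(G)$ (loops are allowed, and $(v,w)$ and $(w,v)$ may both be edges). Write $\overrightarrow{N}_G(v)=\{w:(v,w)\in E(G)\}$ and $\overleftarrow{N}_G(v)=\{w:(w,v)\in E(G)\}$. A vertex $v$ of $G$ is dismantlable if there is a vertex $w\ne v$ with $\overleftarrow{N}_G(v)\subseteq\overleftarrow{N}_G(w)$ and $\overrightarrow{N}_G(v)\subseteq\overrightarrow{N}_G(w)$. A digraph is stiff if it has no dismantlable vertex. A multihomomorphism from $G$ to $H$ is a map $\alpha: V(G)\to 2^{V(H)}\setminus\{\emptyset\}$ such that $\alpha(v)\times\alpha(w)\subseteq E(H)$ for every $(v,w)\in E(G)$. $\overrightarrow{\mathrm{Hom}}(G,H)$ is the polyhedral subcomplex of $\prod_{x\in V(G)}\Delta^{V(H)}$ (where $\Delta^{S}$ is the simplex with vertex set $S$) whose cells are the products $\prod_{x}\Delta^{\alpha(x)}$ over all multihomomorphisms $\alpha$; its vertices are the homomorphisms $G\to H$. Homomorphisms $f,g:G\to H$ are bihomotopic if there is a path between them in $\overrightarrow{\mathrm{Hom}}(G,H)$. A homomorphism $f:G\to H$ is a bihomotopy equivalence if there is a homomorphism $g:H\to G$ with $g\circ f$ bihomotopic to $\mathrm{id}_G$ and $f\circ g$ bihomotopic to $\mathrm{id}_H$. *)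

theory Defs
  imports "HOL-Analysis.Analysis" "Graph_Theory.Pair_Digraph"
begin

(* Finite digraphs without parallel edges, loops allowed, are those satisfying
   pair_fin_digraph; V(G) is pverts G and E(G) is parcs G. Maps between vertex sets are
   total functions on the vertex types, and only their values on V(G) matter. *)

definition out_nbhd :: "'a pair_pre_digraph \<Rightarrow> 'a \<Rightarrow> 'a set" where
  "out_nbhd G v = {w. (v, w) \<in> parcs G}"

definition in_nbhd :: "'a pair_pre_digraph \<Rightarrow> 'a \<Rightarrow> 'a set" where
  "in_nbhd G v = {w. (w, v) \<in> parcs G}"

definition dismantlable :: "'a pair_pre_digraph \<Rightarrow> 'a \<Rightarrow> bool" where
  "dismantlable G v \<longleftrightarrow> v \<in> pverts G \<and>
     (\<exists>w\<in>pverts G. w \<noteq> v \<and> in_nbhd G v \<subseteq> in_nbhd G w \<and> out_nbhd G v \<subseteq> out_nbhd G w)"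

definition stiff :: "'a pair_pre_digraph \<Rightarrow> bool" where
  "stiff G \<longleftrightarrow> \<not> (\<exists>v. dismantlable G v)"

definition digraph_hom :: "'a pair_pre_digraph \<Rightarrow> 'b pair_pre_digraph \<Rightarrow> ('a \<Rightarrow> 'b) \<Rightarrow> bool" where
  "digraph_hom G H f \<longleftrightarrow>
     f \<in> pverts G \<rightarrow> pverts H \<and> (\<forall>(v, w)\<in>parcs G. (f v, f w) \<in> parcs H)"

definition digraph_isom :: "'a pair_pre_digraph \<Rightarrow> 'b pair_pre_digraph \<Rightarrow> ('a \<Rightarrow> 'b) \<Rightarrow> bool" where
  "digraph_isom G H f \<longleftrightarrow> bij_betw f (pverts G) (pverts H) \<and>
     (\<forall>v\<in>pverts G. \<forall>w\<in>pverts G. (v, w) \<in> parcs G \<longleftrightarrow> (f v, f w) \<in> parcs H)"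

definition multihom :: "'a pair_pre_digraph \<Rightarrow> 'b pair_pre_digraph \<Rightarrow> ('a \<Rightarrow> 'b set) \<Rightarrow> bool" where
  "multihom G H \<alpha> \<longleftrightarrow> \<alpha> \<in> pverts G \<rightarrow> Pow (pverts H) - {{}} \<and>
     (\<forall>(v, w)\<in>parcs G. \<alpha> v \<times> \<alpha> w \<subseteq> parcs H)"

(* The simplex with vertex set S in barycentric coordinates (for finite S); for S a subset
   of T it is a face of simplex_on T. *)
definition simplex_on :: "'b set \<Rightarrow> ('b \<Rightarrow> real) set" where
  "simplex_on S = {t. (\<forall>s. 0 \<le> t s) \<and> (\<forall>s. s \<notin> S \<longrightarrow> t s = 0) \<and> sum t S = 1}"

definition Hom_cell :: "'a pair_pre_digraph \<Rightarrow> ('a \<Rightarrow> 'b set) \<Rightarrow> ('a \<Rightarrow> 'b \<Rightarrow> real) set" where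
  "Hom_cell G \<alpha> = (\<Pi>\<^sub>E x\<in>pverts G. simplex_on (\<alpha> x))"

(* The underlying space of the Hom complex. The topology is the one induced from the product
   topology on the function type; since all coordinates outside V(G) and V(H) are constant,
   this is the Euclidean topology of a finite polyhedral complex. *)
definition Hom_complex ::
    "'a pair_pre_digraph \<Rightarrow> 'b pair_pre_digraph \<Rightarrow> ('a \<Rightarrow> 'b \<Rightarrow> real) set" where
  "Hom_complex G H = (\<Union>\<alpha>\<in>{\<alpha>. multihom G H \<alpha>}. Hom_cell G \<alpha>)"

definition Hom_vertex :: "'a pair_pre_digraph \<Rightarrow> ('a \<Rightarrow> 'b) \<Rightarrow> 'a \<Rightarrow> 'b \<Rightarrow> real" where
  "Hom_vertex G f = (\<lambda>x\<in>pverts G. indicator {f x})"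

definition bihomotopic ::
    "'a pair_pre_digraph \<Rightarrow> 'b pair_pre_digraph \<Rightarrow> ('a \<Rightarrow> 'b) \<Rightarrow> ('a \<Rightarrow> 'b) \<Rightarrow> bool" where
  "bihomotopic G H f g \<longleftrightarrow> digraph_hom G H f \<and> digraph_hom G H g \<and>
     path_component (Hom_complex G H) (Hom_vertex G f) (Hom_vertex G g)"

definition bihomotopy_equivalence ::
    "'a pair_pre_digraph \<Rightarrow> 'b pair_pre_digraph \<Rightarrow> ('a \<Rightarrow> 'b) \<Rightarrow> bool" where
  "bihomotopy_equivalence G H f \<longleftrightarrow> digraph_hom G H f \<and>
     (\<exists>g. digraph_hom H G g \<and> bihomotopic G G (g \<circ> f) id \<and> bihomotopic H H (f \<circ> g) id)"

end

theory Submission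
  imports Defs
begin

text \<open>
  In a stiff digraph the identity is rigid. If a multihomomorphism \<open>\<alpha>\<close> from \<open>G\<close> to itself
  satisfies \<open>v \<in> \<alpha> v\<close> for every vertex \<open>v\<close>, then every \<open>w \<in> \<alpha> v\<close> has at least the
  neighbours of \<open>v\<close> in both directions, so \<open>w \<noteq> v\<close> would make \<open>v\<close> dismantlable; hence
  \<open>\<alpha> v = {v}\<close> (\<open>stiff_multihom_id\<close>). Geometrically, the only cell of the Hom complex that has
  the identity as a vertex is the vertex itself, so the identity is an isolated point and no
  other homomorphism is bihomotopic to it (\<open>stiff_path_component_id\<close>).

  Consequently, if \<open>g\<close> is a bihomotopy inverse of \<open>f\<close> between stiff digraphs, then \<open>g \<circ> f\<close> and
  \<open>f \<circ> g\<close> are not merely bihomotopic to the identities but equal to them on vertices, which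
  makes \<open>f\<close> an isomorphism. In the other direction the inverse of an isomorphism is a strict
  inverse, and constant paths serve as the two bihomotopies.
\<close>

lemma stiff_multihom_id:
  assumes "pair_fin_digraph G" and "stiff G" and \<alpha>: "multihom G G \<alpha>"
    and diag: "\<And>v. v \<in> pverts G \<Longrightarrow> v \<in> \<alpha> v" and v: "v \<in> pverts G"
  shows "\<alpha> v = {v}"
proof -
  interpret pair_fin_digraph G by fact
  have "w = v" if w: "w \<in> \<alpha> v" for w
  proof (rule ccontr)
    assume "w \<noteq> v"
    have "w \<in> pverts G"
      using \<alpha> v w by (auto simp: multihom_def Pi_iff)
    have "(u, w) \<in> parcs G" if "(u, v) \<in> parcs G" for u
      using \<alpha> that w diag[of u] in_arcsD1[OF that] by (fastforce simp: multihom_def)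
    moreover have "(w, u) \<in> parcs G" if "(v, u) \<in> parcs G" for u
      using \<alpha> that w diag[of u] in_arcsD2[OF that] by (fastforce simp: multihom_def)
    ultimately have "dismantlable G v"
      using v \<open>w \<in> pverts G\<close> \<open>w \<noteq> v\<close>
      by (auto simp: dismantlable_def in_nbhd_def out_nbhd_def)
    then show False
      using \<open>stiff G\<close> by (simp add: stiff_def)
  qed
  then show ?thesis
    using diag[OF v] by blast
qed

lemma Hom_complex_nonneg:
  assumes "p \<in> Hom_complex G H" and "v \<in> pverts G"
  shows "0 \<le> p v w"
  using assms by (fastforce simp: Hom_complex_def Hom_cell_def simplex_on_def PiE_iff)

text \<open>
  The identity is isolated: points whose diagonal coordinates are all positive form an open
  neighbourhood of it, and the cell of such a point is given by a multihomomorphism to which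
  the rigidity above applies.
\<close>

lemma stiff_Hom_complex_id:
  assumes "pair_fin_digraph G" and "stiff G" and p: "p \<in> Hom_complex G G"
    and pos: "\<And>v. v \<in> pverts G \<Longrightarrow> 0 < p v v"
  shows "p = Hom_vertex G id"
proof -
  obtain \<alpha> where \<alpha>: "multihom G G \<alpha>" and cell: "p \<in> Hom_cell G \<alpha>"
    using p by (auto simp: Hom_complex_def)
  have simplex: "p v \<in> simplex_on (\<alpha> v)" if "v \<in> pverts G" for v
    using cell that by (auto simp: Hom_cell_def PiE_iff)
  have "v \<in> \<alpha> v" if "v \<in> pverts G" for v
    using simplex[OF that] pos[OF that] by (fastforce simp: simplex_on_def)
  then have \<alpha>_id: "\<alpha> v = {v}" if "v \<in> pverts G" for v
    using stiff_multihom_id[OF assms(1,2) \<alpha>] that by blast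
  have "p v = indicator {v}" if "v \<in> pverts G" for v
    using simplex[OF that] \<alpha>_id[OF that] by (auto simp: simplex_on_def indicator_def)
  moreover have "p v = undefined" if "v \<notin> pverts G" for v
    using cell that by (auto simp: Hom_cell_def PiE_iff extensional_def)
  ultimately show ?thesis
    by (auto simp: Hom_vertex_def fun_eq_iff)
qed

text \<open>
  The product of the diagonal coordinates is a continuous function on the complex which is \<open>1\<close>
  at the identity and, as the identity is isolated, \<open>0\<close> elsewhere. By the intermediate value
  theorem it is constant along every path.
\<close>

lemma stiff_path_component_id:
  assumes "pair_fin_digraph G" and "stiff G"
    and "path_component (Hom_complex G G) (Hom_vertex G id) q"
  shows "q = Hom_vertex G id"
proof -
  interpret pair_fin_digraph G by fact
  define h where "h p = (\<Prod>v\<in>pverts G. p v v)" for p :: "'a \<Rightarrow> 'a \<Rightarrow> real"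
  have h_id: "h (Hom_vertex G id) = 1"
    by (simp add: h_def Hom_vertex_def)
  have h_pos: "p = Hom_vertex G id" if "p \<in> Hom_complex G G" "h p \<noteq> 0" for p
  proof (rule stiff_Hom_complex_id[OF assms(1,2) that(1)])
    fix v assume v: "v \<in> pverts G"
    have "p v v \<noteq> 0"
      using that(2) v by (auto simp: h_def)
    then show "0 < p v v"
      using Hom_complex_nonneg[OF that(1) v, of v] by simp
  qed
  obtain \<gamma> where "path \<gamma>" and im: "path_image \<gamma> \<subseteq> Hom_complex G G"
    and start: "\<gamma> 0 = Hom_vertex G id" and finish: "\<gamma> 1 = q"
    using assms(3) by (auto simp: path_component_def pathstart_def pathfinish_def)
  have \<gamma>_in: "\<gamma> t \<in> Hom_complex G G" if "t \<in> {0..1}" for t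
    using im that by (auto simp: path_image_def)
  have "continuous_on {0..1} (\<lambda>t. \<gamma> t v)" for v
    using \<open>path \<gamma>\<close> unfolding path_def by (rule continuous_on_product_then_coordinatewise)
  then have "continuous_on {0..1} (\<lambda>t. \<gamma> t v w)" for v w
    by (rule continuous_on_product_then_coordinatewise)
  then have cont: "continuous_on {0..1} (\<lambda>t. h (\<gamma> t))"
    unfolding h_def by (rule continuous_on_prod)
  have "h q \<noteq> 0"
  proof
    assume "h q = 0"
    then obtain t where t: "t \<in> {0..1}" and half: "h (\<gamma> t) = 1/2"
      using IVT2'[of "\<lambda>t. h (\<gamma> t)" 1 "1/2" 0] cont start finish h_id by auto
    then show False
      using h_pos[OF \<gamma>_in[OF t]] h_id by simp
  qed
  moreover have "q \<in> Hom_complex G G"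
    using \<gamma>_in[of 1] finish by simp
  ultimately show ?thesis
    using h_pos by blast
qed

lemma Hom_vertex_eq_iff:
  "Hom_vertex G f = Hom_vertex G g \<longleftrightarrow> (\<forall>v\<in>pverts G. f v = g v)"
proof
  assume eq: "Hom_vertex G f = Hom_vertex G g"
  show "\<forall>v\<in>pverts G. f v = g v"
  proof
    fix v assume "v \<in> pverts G"
    then have "indicator {f v} (f v) = (indicator {g v} (f v) :: real)"
      using fun_cong[OF fun_cong[OF eq], of v "f v"] by (simp add: Hom_vertex_def)
    then show "f v = g v"
      by (simp add: indicator_def split: if_splits)
  qed
qed (auto simp: Hom_vertex_def fun_eq_iff)

lemma bihomotopic_id_stiff:
  assumes "pair_fin_digraph G" and "stiff G" and "bihomotopic G G f id" and "v \<in> pverts G"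
  shows "f v = v"
proof -
  have "path_component (Hom_complex G G) (Hom_vertex G id) (Hom_vertex G f)"
    using assms(3) unfolding bihomotopic_def by (blast intro: path_component_sym)
  then have "Hom_vertex G f = Hom_vertex G id"
    by (rule stiff_path_component_id[OF assms(1,2)])
  then show ?thesis
    using assms(4) by (simp add: Hom_vertex_eq_iff)
qed

text \<open>A homomorphism is itself a multihomomorphism with singleton values.\<close>

lemma Hom_vertex_in_Hom_complex:
  assumes "digraph_hom G H f"
  shows "Hom_vertex G f \<in> Hom_complex G H"
proof -
  have "multihom G H (\<lambda>v. {f v})"
    using assms by (auto simp: multihom_def digraph_hom_def)
  moreover have "Hom_vertex G f \<in> Hom_cell G (\<lambda>v. {f v})"
    by (auto simp: Hom_cell_def Hom_vertex_def simplex_on_def)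
  ultimately show ?thesis
    by (auto simp: Hom_complex_def)
qed

lemma bihomotopic_if_eq_on_verts:
  assumes "digraph_hom G H f" and "digraph_hom G H g"
    and "\<And>v. v \<in> pverts G \<Longrightarrow> f v = g v"
  shows "bihomotopic G H f g"
proof -
  have "Hom_vertex G f = Hom_vertex G g"
    using assms(3) by (simp add: Hom_vertex_eq_iff)
  then show ?thesis
    using assms(1,2) Hom_vertex_in_Hom_complex[OF assms(1)]
    by (simp add: bihomotopic_def path_component_refl)
qed

lemma digraph_hom_id: "digraph_hom G G id"
  by (auto simp: digraph_hom_def)

lemma digraph_hom_comp:
  "digraph_hom G H f \<Longrightarrow> digraph_hom H K g \<Longrightarrow> digraph_hom G K (g \<circ> f)"
  by (fastforce simp: digraph_hom_def)

lemma digraph_isom_if_inverse: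
  assumes f: "digraph_hom G H f" and g: "digraph_hom H G g"
    and gf: "\<And>v. v \<in> pverts G \<Longrightarrow> g (f v) = v" and fg: "\<And>w. w \<in> pverts H \<Longrightarrow> f (g w) = w"
  shows "digraph_isom G H f"
proof -
  have "bij_betw f (pverts G) (pverts H)"
    using f g gf fg by (intro bij_betw_byWitness[where f' = g]) (auto simp: digraph_hom_def)
  moreover have "(v, w) \<in> parcs G \<longleftrightarrow> (f v, f w) \<in> parcs H"
    if "v \<in> pverts G" "w \<in> pverts G" for v w
  proof
    assume "(f v, f w) \<in> parcs H"
    then have "(g (f v), g (f w)) \<in> parcs G"
      using g by (auto simp: digraph_hom_def)
    then show "(v, w) \<in> parcs G"
      using gf that by simp
  qed (use f in \<open>auto simp: digraph_hom_def\<close>)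
  ultimately show ?thesis
    by (simp add: digraph_isom_def)
qed

lemma digraph_isom_inverse:
  assumes "pair_fin_digraph H" and f: "digraph_isom G H f"
  shows "digraph_hom H G (inv_into (pverts G) f)"
proof -
  interpret pair_fin_digraph H by fact
  let ?g = "inv_into (pverts G) f"
  have bij: "bij_betw f (pverts G) (pverts H)"
    using f by (simp add: digraph_isom_def)
  have g_in: "?g w \<in> pverts G" if "w \<in> pverts H" for w
    using bij_betw_apply[OF bij_betw_inv_into[OF bij] that] .
  have "(?g v, ?g w) \<in> parcs G" if vw: "(v, w) \<in> parcs H" for v w
  proof -
    have v: "v \<in> pverts H" and w: "w \<in> pverts H"
      using in_arcsD1[OF vw] in_arcsD2[OF vw] by auto
    have "(f (?g v), f (?g w)) \<in> parcs H"
      using vw bij_betw_inv_into_right[OF bij] v w by simp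
    then show ?thesis
      using f g_in[OF v] g_in[OF w] by (simp add: digraph_isom_def)
  qed
  then show ?thesis
    using g_in by (auto simp: digraph_hom_def)
qed

theorem corollary6p5:
  fixes G :: "'a pair_pre_digraph" and H :: "'b pair_pre_digraph" and f :: "'a \<Rightarrow> 'b"
  assumes "pair_fin_digraph G" and "pair_fin_digraph H"
    and "stiff G" and "stiff H"
    and "digraph_hom G H f"
  shows "bihomotopy_equivalence G H f \<longleftrightarrow> digraph_isom G H f"
proof
  assume "bihomotopy_equivalence G H f"
  then obtain g where g: "digraph_hom H G g"
    and gf: "bihomotopic G G (g \<circ> f) id" and fg: "bihomotopic H H (f \<circ> g) id"
    by (auto simp: bihomotopy_equivalence_def)
  show "digraph_isom G H f"
    using bihomotopic_id_stiff[OF assms(1,3) gf] bihomotopic_id_stiff[OF assms(2,4) fg]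
    by (intro digraph_isom_if_inverse[OF assms(5) g]) auto
next
  assume isom: "digraph_isom G H f"
  define g where "g = inv_into (pverts G) f"
  have bij: "bij_betw f (pverts G) (pverts H)"
    using isom by (simp add: digraph_isom_def)
  have g: "digraph_hom H G g"
    unfolding g_def by (rule digraph_isom_inverse[OF assms(2) isom])
  have "bihomotopic G G (g \<circ> f) id"
    using bij_betw_inv_into_left[OF bij]
    by (intro bihomotopic_if_eq_on_verts digraph_hom_comp[OF assms(5) g] digraph_hom_id)
      (simp add: g_def)
  moreover have "bihomotopic H H (f \<circ> g) id"
    using bij_betw_inv_into_right[OF bij]
    by (intro bihomotopic_if_eq_on_verts digraph_hom_comp[OF g assms(5)] digraph_hom_id)
      (simp add: g_def)
  ultimately show "bihomotopy_equivalence G H f"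
    using assms(5) g by (auto simp: bihomotopy_equivalence_def)
qed

end
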